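(* The categories $\mathbf{Cat_{pmv}}$ (small categories and partial multivalued functors) and $\mathbf{Cat_{rel}}$ (small categories and relations between them) are isomorphic.
   Context: A partial multivalued function $S\nrightarrow T$ between sets is a function $S\to\mathcal{P}(T)$ to the power set of $T$. **Partial multivalued functors.** A partial multivalued functor $F\colon\mathscr{C}\nrightarrow\mathscr{D}$ between small categories consists of a partial multivalued function $F\colon\mathrm{ob}\,\mathscr{C}\nrightarrow\mathrm{ob}\,\mathscr{D}$ and, for all $C,C'\in\mathrm{ob}\,\mathscr{C}$, a partial multivalued function $F\colon\mathscr{C}(C,C')\nrightarrow\bigcup_{D\in FC,\,D'\in FC'}\mathscr{D}(D,D')$ such that: (i) for all objects $C$ of $\mathscr C$, if $d\in F(\mathrm{id}_C)$ then $d=\mathrm{id}_D$ for some $D\in FC$; (ii) for all morphisms $c''$ of $\mathscr{C}$ and $d''$ of $\mathscr{D}$ with $d''\in F(c'')$, if $c''=c'\circ c$ for morphisms $c,c'$ of $\mathscr{C}$, then there exist $d\in F(c)$ and $d'\in F(c')$ with $d''=d'\circ d$. In $\mathbf{Cat_{pmv}}$ the identities are $C\mapsto\{C\}$, $c\mapsto\{c\}$, and the composite of $F\colon\mathscr{C}\nrightarrow\mathscr{D}$ and $G\colon\mathscr{D}\nrightarrow\mathscr{E}$ is $C\mapsto\bigcup_{D\in FC}GD$, $c\mapsto\bigcup_{d\in Fc}Gd$. **Relations between categories.** A relation $R\colon\mathscr{C}\nrightarrow\mathscr{D}$ between small categories consists of a relation $R$ from $\mathrm{ob}\,\mathscr{C}$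 to $\mathrm{ob}\,\mathscr{D}$ and, for all $C,C'\in\mathrm{ob}\,\mathscr{C}$, a relation $R$ from $\mathscr{C}(C,C')$ to $\bigcup_{C R D,\,C' R D'}\mathscr{D}(D,D')$ such that: (i) for all objects $C$ of $\mathscr C$, if $\mathrm{id}_C\,R\,d$ then $d=\mathrm{id}_D$ for some $D\in\mathrm{ob}\,\mathscr{D}$ with $C R D$; (ii) for all morphisms $c''$ of $\mathscr{C}$ and $d''$ of $\mathscr{D}$ with $c''\,R\,d''$, if $c''=c'\circ c$ for morphisms $c,c'$ of $\mathscr{C}$, then $d''=d'\circ d$ for some morphisms $d,d'$ of $\mathscr{D}$ with $c\,R\,d$ and $c'\,R\,d'$. In $\mathbf{Cat_{rel}}$ the identities are the equality relations on objects and morphisms, and composition is the usual composition of relations, performed on objects and on morphisms. *)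

theory Defs
  imports Main "HOL-Library.FuncSet"
begin

section \<open>Categories, functors, isomorphism of categories\<close>

text \<open>\<open>Comp C g f\<close> is the composite of \<open>g\<close> after \<open>f\<close>. Every arrow has a unique domain and
  codomain, so distinct hom-sets are disjoint.\<close>

record ('o, 'a) cat =
  Obj :: "'o set"
  Arr :: "'a set"
  Dom :: "'a \<Rightarrow> 'o"
  Cod :: "'a \<Rightarrow> 'o"
  Ident :: "'o \<Rightarrow> 'a"
  Comp :: "'a \<Rightarrow> 'a \<Rightarrow> 'a"

definition Hom :: "('o, 'a) cat \<Rightarrow> 'o \<Rightarrow> 'o \<Rightarrow> 'a set" where
  "Hom C X Y = {f \<in> Arr C. Dom C f = X \<and> Cod C f = Y}"

definition composable :: "('o, 'a) cat \<Rightarrow> 'a \<Rightarrow> 'a \<Rightarrow> bool" where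
  "composable C g f \<longleftrightarrow> g \<in> Arr C \<and> f \<in> Arr C \<and> Cod C f = Dom C g"

text \<open>The structure maps take the value \<^term>\<open>undefined\<close> off their domains, so that equality of
  records is equality of categories.\<close>

locale category =
  fixes C :: "('o, 'a) cat"
  assumes Dom_closed: "Dom C \<in> Arr C \<rightarrow>\<^sub>E Obj C"
    and Cod_closed: "Cod C \<in> Arr C \<rightarrow>\<^sub>E Obj C"
    and Ident_extensional: "Ident C \<in> extensional (Obj C)"
    and Comp_undefined: "\<And>f g. \<not> composable C g f \<Longrightarrow> Comp C g f = undefined"
    and Ident_Hom: "\<And>X. X \<in> Obj C \<Longrightarrow> Ident C X \<in> Hom C X X"
    and Comp_Hom: "\<And>X Y Z f g. f \<in> Hom C X Y \<Longrightarrow> g \<in> Hom C Y Z \<Longrightarrow> Comp C g f \<in> Hom C X Z"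
    and Comp_Ident_left: "\<And>X Y f. f \<in> Hom C X Y \<Longrightarrow> Comp C (Ident C Y) f = f"
    and Comp_Ident_right: "\<And>X Y f. f \<in> Hom C X Y \<Longrightarrow> Comp C f (Ident C X) = f"
    and Comp_assoc: "\<And>W X Y Z f g h. f \<in> Hom C W X \<Longrightarrow> g \<in> Hom C X Y \<Longrightarrow> h \<in> Hom C Y Z \<Longrightarrow>
      Comp C h (Comp C g f) = Comp C (Comp C h g) f"

definition is_functor ::
  "('o, 'a) cat \<Rightarrow> ('p, 'b) cat \<Rightarrow> ('o \<Rightarrow> 'p) \<Rightarrow> ('a \<Rightarrow> 'b) \<Rightarrow> bool" where
  "is_functor C D Fo Fa \<longleftrightarrow>
    category C \<and> category D \<and>
    (\<forall>X \<in> Obj C. Fo X \<in> Obj D) \<and>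
    (\<forall>X \<in> Obj C. \<forall>Y \<in> Obj C. \<forall>f \<in> Hom C X Y. Fa f \<in> Hom D (Fo X) (Fo Y)) \<and>
    (\<forall>X \<in> Obj C. Fa (Ident C X) = Ident D (Fo X)) \<and>
    (\<forall>f g. composable C g f \<longrightarrow> Fa (Comp C g f) = Comp D (Fa g) (Fa f))"

definition isomorphic_categories :: "('o, 'a) cat \<Rightarrow> ('p, 'b) cat \<Rightarrow> bool" where
  "isomorphic_categories C D \<longleftrightarrow>
    (\<exists>Fo Fa Go Ga. is_functor C D Fo Fa \<and> is_functor D C Go Ga \<and>
      (\<forall>X \<in> Obj C. Go (Fo X) = X) \<and> (\<forall>f \<in> Arr C. Ga (Fa f) = f) \<and>
      (\<forall>Y \<in> Obj D. Fo (Go Y) = Y) \<and> (\<forall>g \<in> Arr D. Fa (Ga g) = g))"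

text \<open>\<open>small\<close> singles out the small sets among the sets of elements of the ambient type \<open>'u\<close>.
  When \<open>'u\<close> is a Grothendieck universe, \<open>small A\<close> says that the set \<open>A\<close> is an element of it; with
  \<open>small = (\<lambda>A. True)\<close> one gets all categories whose objects and arrows are taken from \<open>'u\<close>.\<close>

definition small_category :: "('u set \<Rightarrow> bool) \<Rightarrow> ('u, 'u) cat \<Rightarrow> bool" where
  "small_category small C \<longleftrightarrow> category C \<and> small (Obj C) \<and> small (Arr C)"

text \<open>An arrow of a category of small categories: its source, its target, and its parts on objects
  and on arrows. The parts are set-valued functions (for partial multivalued functors) or
  relations.\<close>

record ('u, 'x) cat_arrow =
  Src :: "('u, 'u) cat"
  Tgt :: "('u, 'u) cat"
  On_Obj :: 'x
  On_Arr :: 'x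


section \<open>Partial multivalued functors\<close>

text \<open>As hom-sets are disjoint, a family of partial multivalued functions indexed by the hom-sets of
  \<open>C\<close> is the same as a single one on \<^term>\<open>Arr C\<close>; likewise for relations below.\<close>

definition pmv_functor ::
  "('o, 'a) cat \<Rightarrow> ('p, 'b) cat \<Rightarrow> ('o \<Rightarrow> 'p set) \<Rightarrow> ('a \<Rightarrow> 'b set) \<Rightarrow> bool" where
  "pmv_functor C D Fo Fa \<longleftrightarrow>
    Fo \<in> Obj C \<rightarrow>\<^sub>E Pow (Obj D) \<and>
    Fa \<in> Arr C \<rightarrow>\<^sub>E Pow (Arr D) \<and>
    (\<forall>X \<in> Obj C. \<forall>X' \<in> Obj C. \<forall>c \<in> Hom C X X'.
      Fa c \<subseteq> (\<Union>Y \<in> Fo X. \<Union>Y' \<in> Fo X'. Hom D Y Y')) \<and>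
    (\<forall>X \<in> Obj C. \<forall>d \<in> Fa (Ident C X). \<exists>Y \<in> Fo X. d = Ident D Y) \<and>
    (\<forall>c'' \<in> Arr C. \<forall>d'' \<in> Fa c''. \<forall>c c'. composable C c' c \<and> c'' = Comp C c' c \<longrightarrow>
      (\<exists>d \<in> Fa c. \<exists>d' \<in> Fa c'. composable D d' d \<and> d'' = Comp D d' d))"

type_synonym 'u pmv_arrow = "('u, 'u \<Rightarrow> 'u set) cat_arrow"

definition pmv_arrows :: "('u set \<Rightarrow> bool) \<Rightarrow> 'u pmv_arrow set" where
  "pmv_arrows small = {F. small_category small (Src F) \<and> small_category small (Tgt F) \<and>
     pmv_functor (Src F) (Tgt F) (On_Obj F) (On_Arr F)}"

definition pmv_ident :: "('u, 'u) cat \<Rightarrow> 'u pmv_arrow" where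
  "pmv_ident C = \<lparr>Src = C, Tgt = C, On_Obj = (\<lambda>X \<in> Obj C. {X}), On_Arr = (\<lambda>c \<in> Arr C. {c})\<rparr>"

definition pmv_comp :: "'u pmv_arrow \<Rightarrow> 'u pmv_arrow \<Rightarrow> 'u pmv_arrow" where
  "pmv_comp G F = \<lparr>Src = Src F, Tgt = Tgt G,
     On_Obj = (\<lambda>X \<in> Obj (Src F). \<Union>Y \<in> On_Obj F X. On_Obj G Y),
     On_Arr = (\<lambda>c \<in> Arr (Src F). \<Union>d \<in> On_Arr F c. On_Arr G d)\<rparr>"

definition Cat_pmv :: "('u set \<Rightarrow> bool) \<Rightarrow> (('u, 'u) cat, 'u pmv_arrow) cat" where
  "Cat_pmv small = \<lparr>
     Obj = {C. small_category small C},
     Arr = pmv_arrows small,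
     Dom = restrict Src (pmv_arrows small),
     Cod = restrict Tgt (pmv_arrows small),
     Ident = restrict pmv_ident {C. small_category small C},
     Comp = (\<lambda>G F. if G \<in> pmv_arrows small \<and> F \<in> pmv_arrows small \<and> Tgt F = Src G
                   then pmv_comp G F else undefined)\<rparr>"


section \<open>Relations between categories\<close>

definition cat_relation ::
  "('o, 'a) cat \<Rightarrow> ('p, 'b) cat \<Rightarrow> ('o \<times> 'p) set \<Rightarrow> ('a \<times> 'b) set \<Rightarrow> bool" where
  "cat_relation C D Ro Ra \<longleftrightarrow>
    Ro \<subseteq> Obj C \<times> Obj D \<and>
    Ra \<subseteq> Arr C \<times> Arr D \<and>
    (\<forall>X \<in> Obj C. \<forall>X' \<in> Obj C. \<forall>c \<in> Hom C X X'. \<forall>d. (c, d) \<in> Ra \<longrightarrow>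
      d \<in> \<Union> {Hom D Y Y' | Y Y'. (X, Y) \<in> Ro \<and> (X', Y') \<in> Ro}) \<and>
    (\<forall>X \<in> Obj C. \<forall>d. (Ident C X, d) \<in> Ra \<longrightarrow>
      (\<exists>Y \<in> Obj D. (X, Y) \<in> Ro \<and> d = Ident D Y)) \<and>
    (\<forall>c'' \<in> Arr C. \<forall>d'' \<in> Arr D. (c'', d'') \<in> Ra \<longrightarrow>
      (\<forall>c c'. composable C c' c \<and> c'' = Comp C c' c \<longrightarrow>
        (\<exists>d d'. composable D d' d \<and> d'' = Comp D d' d \<and> (c, d) \<in> Ra \<and> (c', d') \<in> Ra)))"

type_synonym 'u rel_arrow = "('u, ('u \<times> 'u) set) cat_arrow"

definition rel_arrows :: "('u set \<Rightarrow> bool) \<Rightarrow> 'u rel_arrow set" where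
  "rel_arrows small = {R. small_category small (Src R) \<and> small_category small (Tgt R) \<and>
     cat_relation (Src R) (Tgt R) (On_Obj R) (On_Arr R)}"

definition rel_ident :: "('u, 'u) cat \<Rightarrow> 'u rel_arrow" where
  "rel_ident C = \<lparr>Src = C, Tgt = C, On_Obj = Id_on (Obj C), On_Arr = Id_on (Arr C)\<rparr>"

text \<open>The infix \<open>O\<close> composes relations in diagrammatic order.\<close>

definition rel_comp :: "'u rel_arrow \<Rightarrow> 'u rel_arrow \<Rightarrow> 'u rel_arrow" where
  "rel_comp S R = \<lparr>Src = Src R, Tgt = Tgt S,
     On_Obj = On_Obj R O On_Obj S, On_Arr = On_Arr R O On_Arr S\<rparr>"

definition Cat_rel :: "('u set \<Rightarrow> bool) \<Rightarrow> (('u, 'u) cat, 'u rel_arrow) cat" where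
  "Cat_rel small = \<lparr>
     Obj = {C. small_category small C},
     Arr = rel_arrows small,
     Dom = restrict Src (rel_arrows small),
     Cod = restrict Tgt (rel_arrows small),
     Ident = restrict rel_ident {C. small_category small C},
     Comp = (\<lambda>S R. if S \<in> rel_arrows small \<and> R \<in> rel_arrows small \<and> Tgt R = Src S
                   then rel_comp S R else undefined)\<rparr>"

end

theory Submission
  imports Defs
begin

text \<open>A set-valued function \<open>f\<close> on \<open>A\<close> and its graph \<^term>\<open>Sigma A f\<close> determine each other, and the
  two axioms of a partial multivalued functor are those of a relation between categories, read
  through this correspondence. It also turns unions over images into relational composition, so it
  is an isomorphism of categories that is the identity on objects. That \<^term>\<open>Cat_pmv small\<close> is a
  category is transported along the correspondence from \<^term>\<open>Cat_rel small\<close>.\<close>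

section \<open>Set-valued functions and their graphs\<close>

definition fibres :: "'a set \<Rightarrow> ('a \<times> 'b) set \<Rightarrow> 'a \<Rightarrow> 'b set" where
  "fibres A R = (\<lambda>x \<in> A. R `` {x})"

lemma Sigma_fibres: "R \<subseteq> A \<times> B \<Longrightarrow> Sigma A (fibres A R) = R"
  by (auto simp: fibres_def)

text \<open>Off \<open>A\<close> both sides are \<open>undefined\<close>, the left by the
  restriction in \<open>fibres\<close> and the right by extensionality. Without extensionality the
  graph would determine \<open>f\<close> on \<open>A\<close> only.\<close>

lemma fibres_Sigma: "f \<in> extensional A \<Longrightarrow> fibres A (Sigma A f) = f"
  by (auto simp: fibres_def extensional_def fun_eq_iff)

text \<open>The clauses match one by one, and extensionality is listed apart because a graph over
  \<open>A\<close> does not see values off \<open>A\<close>. That \<open>C\<close> is a category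
  puts \<open>Ident C X\<close> into \<open>Arr C\<close>, so the graph relates it to exactly the
  elements of \<open>Fa (Ident C X)\<close>.\<close>

lemma pmv_functor_iff_cat_relation:
  assumes "category C"
  shows "pmv_functor C D Fo Fa \<longleftrightarrow>
    Fo \<in> extensional (Obj C) \<and> Fa \<in> extensional (Arr C) \<and>
    cat_relation C D (Sigma (Obj C) Fo) (Sigma (Arr C) Fa)"
proof -
  interpret category C by fact
  have I: "Ident C X \<in> Arr C" if "X \<in> Obj C" for X
    using Ident_Hom[OF that] by (simp add: Hom_def)
  have hom: "(\<forall>c \<in> Hom C X X'. Fa c \<subseteq> (\<Union>Y \<in> Fo X. \<Union>Y' \<in> Fo X'. Hom D Y Y')) \<longleftrightarrow>
      (\<forall>c \<in> Hom C X X'. \<forall>d. (c, d) \<in> Sigma (Arr C) Fa \<longrightarrow>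
        d \<in> \<Union> {Hom D Y Y' | Y Y'. (X, Y) \<in> Sigma (Obj C) Fo \<and> (X', Y') \<in> Sigma (Obj C) Fo})"
    if "X \<in> Obj C" "X' \<in> Obj C" for X X'
  proof (intro ball_cong refl)
    fix c assume "c \<in> Hom C X X'"
    then have "c \<in> Arr C" by (simp add: Hom_def)
    then show "Fa c \<subseteq> (\<Union>Y \<in> Fo X. \<Union>Y' \<in> Fo X'. Hom D Y Y') \<longleftrightarrow>
        (\<forall>d. (c, d) \<in> Sigma (Arr C) Fa \<longrightarrow>
          d \<in> \<Union> {Hom D Y Y' | Y Y'. (X, Y) \<in> Sigma (Obj C) Fo \<and> (X', Y') \<in> Sigma (Obj C) Fo})"
      using that by blast
  qed
  have ident: "(\<forall>X \<in> Obj C. \<forall>d \<in> Fa (Ident C X). \<exists>Y \<in> Fo X. d = Ident D Y) \<longleftrightarrow>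
      (\<forall>X \<in> Obj C. \<forall>d. (Ident C X, d) \<in> Sigma (Arr C) Fa \<longrightarrow>
        (\<exists>Y \<in> Obj D. (X, Y) \<in> Sigma (Obj C) Fo \<and> d = Ident D Y))"
    if "Sigma (Obj C) Fo \<subseteq> Obj C \<times> Obj D"
    using that I by blast
  \<comment> \<open>The relational axiom lets \<open>d''\<close> range over \<open>Arr D\<close>
    only; the inclusion places every value of \<open>Fa c''\<close> there. Composability puts both
    factors into \<open>Arr C\<close>, where the graph and \<open>Fa\<close> carry the same
    information.\<close>
  have comp: "(\<forall>c'' \<in> Arr C. \<forall>d'' \<in> Fa c''. \<forall>c c'. composable C c' c \<and> c'' = Comp C c' c \<longrightarrow>
      (\<exists>d \<in> Fa c. \<exists>d' \<in> Fa c'. composable D d' d \<and> d'' = Comp D d' d)) \<longleftrightarrow>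
      (\<forall>c'' \<in> Arr C. \<forall>d'' \<in> Arr D. (c'', d'') \<in> Sigma (Arr C) Fa \<longrightarrow>
        (\<forall>c c'. composable C c' c \<and> c'' = Comp C c' c \<longrightarrow>
          (\<exists>d d'. composable D d' d \<and> d'' = Comp D d' d \<and>
            (c, d) \<in> Sigma (Arr C) Fa \<and> (c', d') \<in> Sigma (Arr C) Fa)))"
    if "Sigma (Arr C) Fa \<subseteq> Arr C \<times> Arr D"
  proof -
    have "(\<exists>d \<in> Fa c. \<exists>d' \<in> Fa c'. composable D d' d \<and> d'' = Comp D d' d) \<longleftrightarrow>
        (\<exists>d d'. composable D d' d \<and> d'' = Comp D d' d \<and>
          (c, d) \<in> Sigma (Arr C) Fa \<and> (c', d') \<in> Sigma (Arr C) Fa)"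
      if "composable C c' c" for c c' d''
      using that by (auto simp: composable_def)
    moreover have "(\<forall>d \<in> Fa c. P d) \<longleftrightarrow> (\<forall>d \<in> Arr D. (c, d) \<in> Sigma (Arr C) Fa \<longrightarrow> P d)"
      if "c \<in> Arr C" for c and P
      using that \<open>Sigma (Arr C) Fa \<subseteq> Arr C \<times> Arr D\<close> by auto
    ultimately show ?thesis
      by (simp cong: conj_cong)
  qed
  have PiE: "f \<in> A \<rightarrow>\<^sub>E Pow B \<longleftrightarrow> f \<in> extensional A \<and> Sigma A f \<subseteq> A \<times> B"
    for f :: "'x \<Rightarrow> 'y set" and A B
    by (auto simp: PiE_def)
  have homs: "(\<forall>X \<in> Obj C. \<forall>X' \<in> Obj C. \<forall>c \<in> Hom C X X'.
        Fa c \<subseteq> (\<Union>Y \<in> Fo X. \<Union>Y' \<in> Fo X'. Hom D Y Y')) \<longleftrightarrow>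
      (\<forall>X \<in> Obj C. \<forall>X' \<in> Obj C. \<forall>c \<in> Hom C X X'. \<forall>d. (c, d) \<in> Sigma (Arr C) Fa \<longrightarrow>
        d \<in> \<Union> {Hom D Y Y' | Y Y'. (X, Y) \<in> Sigma (Obj C) Fo \<and> (X', Y') \<in> Sigma (Obj C) Fo})"
    by (intro ball_cong refl hom)
  \<comment> \<open>The equivalences \<open>ident\<close> and \<open>comp\<close> presuppose that
    the graphs lie in the products of the carriers. If one of these inclusions fails, both sides are
    false: each of them contains the inclusions as a condition, on the left through
    \<open>PiE\<close>.\<close>
  show ?thesis
  proof (cases "Sigma (Obj C) Fo \<subseteq> Obj C \<times> Obj D \<and> Sigma (Arr C) Fa \<subseteq> Arr C \<times> Arr D")
    case True
    show ?thesis
      unfolding pmv_functor_def cat_relation_def PiE homs ident[OF conjunct1[OF True]]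
        comp[OF conjunct2[OF True]]
      by (intro iffI; elim conjE; intro conjI; assumption)
  next
    case False
    show ?thesis
      unfolding pmv_functor_def cat_relation_def PiE
      by (insert False) (intro iffI; elim conjE; elim notE; intro conjI; assumption)
  qed
qed

section \<open>Identities and composites of relations between categories\<close>

lemma cat_relation_Id_on: "cat_relation C C (Id_on (Obj C)) (Id_on (Arr C))"
  unfolding cat_relation_def
proof (intro conjI ballI allI impI)
  fix c'' d'' c c'
  assume "(c'', d'') \<in> Id_on (Arr C)" "composable C c' c \<and> c'' = Comp C c' c"
  then show "\<exists>d d'. composable C d' d \<and> d'' = Comp C d' d \<and>
      (c, d) \<in> Id_on (Arr C) \<and> (c', d') \<in> Id_on (Arr C)"
    by (intro exI[of _ c] exI[of _ c']) (auto simp: composable_def)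
next
  fix X X' c d
  assume "X \<in> Obj C" "X' \<in> Obj C" "c \<in> Hom C X X'" "(c, d) \<in> Id_on (Arr C)"
  then show "d \<in> \<Union> {Hom C Y Y' | Y Y'. (X, Y) \<in> Id_on (Obj C) \<and> (X', Y') \<in> Id_on (Obj C)}"
    by (intro UnionI[of "Hom C X X'"] CollectI exI[of _ X] exI[of _ X']) auto
qed auto

text \<open>Every axiom is lifted in two stages. The axiom for \<open>R\<close> yields in
  \<open>D\<close> data of the same kind as in \<open>C\<close> (a hom-set, an identity, a
  factorization), and to these the axiom for \<open>S\<close> applies.\<close>

lemma cat_relation_relcomp:
  assumes R: "cat_relation C D Ro Ra" and S: "cat_relation D E So Sa"
  shows "cat_relation C E (Ro O So) (Ra O Sa)"
proof -
  have sub: "Ro \<subseteq> Obj C \<times> Obj D" "Ra \<subseteq> Arr C \<times> Arr D" "So \<subseteq> Obj D \<times> Obj E" "Sa \<subseteq> Arr D \<times> Arr E"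
    using assms by (simp_all add: cat_relation_def)
  have hom: "e \<in> \<Union> {Hom E Z Z' | Z Z'. (X, Z) \<in> Ro O So \<and> (X', Z') \<in> Ro O So}"
    if X: "X \<in> Obj C" "X' \<in> Obj C" "c \<in> Hom C X X'" and ce: "(c, e) \<in> Ra O Sa" for X X' c e
  proof -
    obtain d where d: "(c, d) \<in> Ra" "(d, e) \<in> Sa" using ce by blast
    obtain Y Y' where Y: "d \<in> Hom D Y Y'" "(X, Y) \<in> Ro" "(X', Y') \<in> Ro"
      using R X d(1) unfolding cat_relation_def by blast
    then have "Y \<in> Obj D" "Y' \<in> Obj D" using sub by auto
    then obtain Z Z' where "e \<in> Hom E Z Z'" "(Y, Z) \<in> So" "(Y', Z') \<in> So"
      using S Y(1) d(2) unfolding cat_relation_def by blast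
    then show ?thesis using Y by blast
  qed
  have ident: "\<exists>Z \<in> Obj E. (X, Z) \<in> Ro O So \<and> e = Ident E Z"
    if X: "X \<in> Obj C" and e: "(Ident C X, e) \<in> Ra O Sa" for X e
  proof -
    obtain d where d: "(Ident C X, d) \<in> Ra" "(d, e) \<in> Sa" using e by blast
    obtain Y where "Y \<in> Obj D" "(X, Y) \<in> Ro" "d = Ident D Y"
      using R X d(1) unfolding cat_relation_def by blast
    moreover from this obtain Z where "Z \<in> Obj E" "(Y, Z) \<in> So" "e = Ident E Z"
      using S d(2) unfolding cat_relation_def by blast
    ultimately show ?thesis by blast
  qed
  \<comment> \<open>The composite stands in for \<open>c''\<close>, as it does once the equation for
    \<open>c''\<close> is substituted. Its membership in \<open>Arr C\<close> is inherited from the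
    range of \<open>c''\<close>, since \<open>C\<close> is not known here to be closed under
    composition.\<close>
  have comp: "\<exists>e e'. composable E e' e \<and> e'' = Comp E e' e \<and> (c, e) \<in> Ra O Sa \<and> (c', e') \<in> Ra O Sa"
    if c: "Comp C c' c \<in> Arr C" "composable C c' c" and e: "(Comp C c' c, e'') \<in> Ra O Sa"
    for c c' e''
  proof -
    obtain d'' where d: "(Comp C c' c, d'') \<in> Ra" "(d'', e'') \<in> Sa" using e by blast
    have mem: "d'' \<in> Arr D" "e'' \<in> Arr E" using sub d by auto
    obtain d d' where "composable D d' d" "d'' = Comp D d' d" "(c, d) \<in> Ra" "(c', d') \<in> Ra"
      using R c d(1) mem unfolding cat_relation_def by blast
    moreover from this obtain e e' where
      "composable E e' e" "e'' = Comp E e' e" "(d, e) \<in> Sa" "(d', e') \<in> Sa"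
      using S d(2) mem unfolding cat_relation_def by blast
    ultimately show ?thesis by blast
  qed
  show ?thesis
    unfolding cat_relation_def
  proof (intro conjI)
    show "Ro O So \<subseteq> Obj C \<times> Obj E" "Ra O Sa \<subseteq> Arr C \<times> Arr E"
      using sub by auto
  qed ((intro ballI allI impI hom; assumption), (intro ballI allI impI ident; assumption),
      (intro ballI allI impI, elim conjE, hypsubst, intro comp; assumption))
qed

section \<open>The category of small categories and relations\<close>

lemma rel_ident_in_rel_arrows: "small_category small C \<Longrightarrow> rel_ident C \<in> rel_arrows small"
  by (simp add: rel_arrows_def rel_ident_def cat_relation_Id_on)

lemma rel_comp_in_rel_arrows:
  "R \<in> rel_arrows small \<Longrightarrow> S \<in> rel_arrows small \<Longrightarrow> Tgt R = Src S \<Longrightarrow> rel_comp S R \<in> rel_arrows small"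
  by (auto simp: rel_arrows_def rel_comp_def intro: cat_relation_relcomp)

lemma On_rel_arrow_subset:
  assumes "R \<in> rel_arrows small"
  shows "On_Obj R \<subseteq> Obj (Src R) \<times> Obj (Tgt R)" "On_Arr R \<subseteq> Arr (Src R) \<times> Arr (Tgt R)"
  using assms by (simp_all add: rel_arrows_def cat_relation_def)

text \<open>\<open>Id_on\<close> is a unit only for relations between the given carriers, which is
  what \<open>On_rel_arrow_subset\<close> supplies.\<close>

lemma rel_comp_rel_ident:
  assumes "R \<in> rel_arrows small"
  shows "rel_comp (rel_ident (Tgt R)) R = R" "rel_comp R (rel_ident (Src R)) = R"
proof -
  have "r O Id_on B = r" "Id_on A O r = r" if "r \<subseteq> A \<times> B" for r :: "('a \<times> 'a) set" and A B
    using that by auto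
  then show "rel_comp (rel_ident (Tgt R)) R = R" "rel_comp R (rel_ident (Src R)) = R"
    using On_rel_arrow_subset[OF assms] by (simp_all add: rel_comp_def rel_ident_def)
qed

lemma rel_comp_assoc: "rel_comp T (rel_comp S R) = rel_comp (rel_comp T S) R"
  by (simp add: rel_comp_def O_assoc)

text \<open>The laws hold for the bare operations \<open>rel_ident\<close> and
  \<open>rel_comp\<close>. It remains to see that identities and composites are again arrows with
  the right source and target, so that the guard in \<open>Comp\<close> is satisfied.\<close>

lemma category_Cat_rel: "category (Cat_rel small)"
proof
  show "Dom (Cat_rel small) \<in> Arr (Cat_rel small) \<rightarrow>\<^sub>E Obj (Cat_rel small)"
    and "Cod (Cat_rel small) \<in> Arr (Cat_rel small) \<rightarrow>\<^sub>E Obj (Cat_rel small)"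
    by (auto simp: Cat_rel_def rel_arrows_def)
next
  fix f g assume "\<not> composable (Cat_rel small) g f"
  then show "Comp (Cat_rel small) g f = undefined"
    by (auto simp: Cat_rel_def composable_def)
next
  fix X assume "X \<in> Obj (Cat_rel small)"
  then show "Ident (Cat_rel small) X \<in> Hom (Cat_rel small) X X"
    using rel_ident_in_rel_arrows[of small X] by (simp add: Cat_rel_def Hom_def) (simp add: rel_ident_def)
next
  fix X Y Z f g
  assume "f \<in> Hom (Cat_rel small) X Y" "g \<in> Hom (Cat_rel small) Y Z"
  then show "Comp (Cat_rel small) g f \<in> Hom (Cat_rel small) X Z"
    using rel_comp_in_rel_arrows[of f small g]
    by (auto simp: Cat_rel_def Hom_def) (auto simp: rel_comp_def)
next
  fix X Y f
  assume f: "f \<in> Hom (Cat_rel small) X Y"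
  then have "f \<in> rel_arrows small" "Src f = X" "Tgt f = Y" "small_category small X" "small_category small Y"
    by (auto simp: Cat_rel_def Hom_def rel_arrows_def)
  with rel_comp_rel_ident[of f small]
  show "Comp (Cat_rel small) (Ident (Cat_rel small) Y) f = f"
    and "Comp (Cat_rel small) f (Ident (Cat_rel small) X) = f"
    using rel_ident_in_rel_arrows[of small X] rel_ident_in_rel_arrows[of small Y]
    by (auto simp: Cat_rel_def) (auto simp: rel_ident_def)
next
  fix W X Y Z f g h
  assume "f \<in> Hom (Cat_rel small) W X" "g \<in> Hom (Cat_rel small) X Y" "h \<in> Hom (Cat_rel small) Y Z"
  then show "Comp (Cat_rel small) h (Comp (Cat_rel small) g f) =
      Comp (Cat_rel small) (Comp (Cat_rel small) h g) f"
    using rel_comp_in_rel_arrows[of f small g] rel_comp_in_rel_arrows[of g small h]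
    by (auto simp: Cat_rel_def Hom_def rel_comp_assoc) (auto simp: rel_comp_def)
qed (simp add: Cat_rel_def)

section \<open>Pulling the category laws back along an injective map\<close>

text \<open>Each unit or associativity law equates two parallel arrows of \<open>C\<close>. Their
  images under \<open>Fa\<close> agree by the same law in \<open>D\<close>, and injectivity cancels
  \<open>Fa\<close>. The preservation properties are assumed singly because
  \<open>is_functor\<close> already contains the conclusion that \<open>C\<close> is a
  category.\<close>

lemma category_reflect:
  assumes D: "category D"
    and ext: "Dom C \<in> Arr C \<rightarrow>\<^sub>E Obj C" "Cod C \<in> Arr C \<rightarrow>\<^sub>E Obj C" "Ident C \<in> extensional (Obj C)"
      "\<And>f g. \<not> composable C g f \<Longrightarrow> Comp C g f = undefined"
    and Ident: "\<And>X. X \<in> Obj C \<Longrightarrow> Ident C X \<in> Hom C X X"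
    and Comp: "\<And>X Y Z f g. f \<in> Hom C X Y \<Longrightarrow> g \<in> Hom C Y Z \<Longrightarrow> Comp C g f \<in> Hom C X Z"
    and inj: "inj_on Fa (Arr C)"
    and Hom: "\<And>X Y f. f \<in> Hom C X Y \<Longrightarrow> Fa f \<in> Hom D (Fo X) (Fo Y)"
    and F_Ident: "\<And>X. X \<in> Obj C \<Longrightarrow> Fa (Ident C X) = Ident D (Fo X)"
    and F_Comp: "\<And>X Y Z f g. f \<in> Hom C X Y \<Longrightarrow> g \<in> Hom C Y Z \<Longrightarrow>
      Fa (Comp C g f) = Comp D (Fa g) (Fa f)"
  shows "category C"
proof -
  interpret D: category D by fact
  have eq: "f = g" if "f \<in> Hom C X Y" "g \<in> Hom C X Y" "Fa f = Fa g" for X Y f g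
    using inj that by (auto simp: Hom_def dest: inj_onD)
  have obj: "X \<in> Obj C" "Y \<in> Obj C" if "f \<in> Hom C X Y" for X Y f
    using ext(1,2) that by (auto simp: Hom_def)
  show ?thesis
  proof
    fix X Y f assume f: "f \<in> Hom C X Y"
    note X = Ident[OF obj(1)[OF f]] and Y = Ident[OF obj(2)[OF f]]
    show "Comp C (Ident C Y) f = f"
      by (rule eq[OF Comp[OF f Y] f])
        (simp add: F_Comp[OF f Y] F_Ident[OF obj(2)[OF f]] D.Comp_Ident_left[OF Hom[OF f]])
    show "Comp C f (Ident C X) = f"
      by (rule eq[OF Comp[OF X f] f])
        (simp add: F_Comp[OF X f] F_Ident[OF obj(1)[OF f]] D.Comp_Ident_right[OF Hom[OF f]])
  next
    fix W X Y Z f g h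
    assume f: "f \<in> Hom C W X" and g: "g \<in> Hom C X Y" and h: "h \<in> Hom C Y Z"
    show "Comp C h (Comp C g f) = Comp C (Comp C h g) f"
      by (rule eq[OF Comp[OF Comp[OF f g] h] Comp[OF f Comp[OF g h]]])
        (simp add: F_Comp[OF Comp[OF f g] h] F_Comp[OF f g] F_Comp[OF f Comp[OF g h]] F_Comp[OF g h]
          D.Comp_assoc[OF Hom[OF f] Hom[OF g] Hom[OF h]])
  qed (use ext Ident Comp in auto)
qed

section \<open>Arrows and their graphs\<close>

definition rel_of_pmv :: "'u pmv_arrow \<Rightarrow> 'u rel_arrow" where
  "rel_of_pmv F = \<lparr>Src = Src F, Tgt = Tgt F,
     On_Obj = Sigma (Obj (Src F)) (On_Obj F), On_Arr = Sigma (Arr (Src F)) (On_Arr F)\<rparr>"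

definition pmv_of_rel :: "'u rel_arrow \<Rightarrow> 'u pmv_arrow" where
  "pmv_of_rel R = \<lparr>Src = Src R, Tgt = Tgt R,
     On_Obj = fibres (Obj (Src R)) (On_Obj R), On_Arr = fibres (Arr (Src R)) (On_Arr R)\<rparr>"

text \<open>Extensionality is all that the graph forgets. In this form, closure properties of
  \<open>rel_arrows\<close> carry over to \<open>pmv_arrows\<close>.\<close>

lemma pmv_arrows_iff:
  "F \<in> pmv_arrows small \<longleftrightarrow> rel_of_pmv F \<in> rel_arrows small \<and>
     On_Obj F \<in> extensional (Obj (Src F)) \<and> On_Arr F \<in> extensional (Arr (Src F))"
  by (auto simp: pmv_arrows_def rel_arrows_def rel_of_pmv_def small_category_def
      pmv_functor_iff_cat_relation)

lemma rel_of_pmv_of_rel: "R \<in> rel_arrows small \<Longrightarrow> rel_of_pmv (pmv_of_rel R) = R"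
  using On_rel_arrow_subset[of R small]
  by (auto simp: rel_of_pmv_def pmv_of_rel_def Sigma_fibres intro!: cat_arrow.equality)

lemma pmv_of_rel_of_pmv: "F \<in> pmv_arrows small \<Longrightarrow> pmv_of_rel (rel_of_pmv F) = F"
  by (auto simp: pmv_arrows_iff rel_of_pmv_def pmv_of_rel_def fibres_Sigma intro!: cat_arrow.equality)

lemma pmv_of_rel_in_pmv_arrows: "R \<in> rel_arrows small \<Longrightarrow> pmv_of_rel R \<in> pmv_arrows small"
  by (simp add: pmv_arrows_iff rel_of_pmv_of_rel) (simp add: pmv_of_rel_def fibres_def)

lemma rel_of_pmv_ident: "rel_of_pmv (pmv_ident C) = rel_ident C"
  by (auto simp: rel_of_pmv_def pmv_ident_def rel_ident_def)

text \<open>The graph of \<open>G\<close> has only pairs over its source, so relational composition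
  could lose intermediate elements lying elsewhere. There are none, since the values of
  \<open>F\<close> lie in \<open>Tgt F = Src G\<close>.\<close>

lemma rel_of_pmv_comp:
  assumes "F \<in> pmv_arrows small" "Tgt F = Src G"
  shows "rel_of_pmv (pmv_comp G F) = rel_comp (rel_of_pmv G) (rel_of_pmv F)"
proof -
  have "On_Obj F X \<subseteq> Obj (Src G)" if "X \<in> Obj (Src F)" for X
    using assms that by (auto simp: pmv_arrows_def pmv_functor_def)
  moreover have "On_Arr F c \<subseteq> Arr (Src G)" if "c \<in> Arr (Src F)" for c
    using assms that by (auto simp: pmv_arrows_def pmv_functor_def)
  ultimately show ?thesis
    by (fastforce simp: rel_of_pmv_def pmv_comp_def rel_comp_def)
qed

lemma pmv_ident_in_pmv_arrows: "small_category small C \<Longrightarrow> pmv_ident C \<in> pmv_arrows small"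
  by (simp add: pmv_arrows_iff rel_of_pmv_ident rel_ident_in_rel_arrows) (simp add: pmv_ident_def)

text \<open>The factorization axiom need not be checked again: the graph of the composite is a
  composite of graphs, and extensionality comes from the restrictions in
  \<open>pmv_comp\<close>.\<close>

lemma pmv_comp_in_pmv_arrows:
  assumes "F \<in> pmv_arrows small" "G \<in> pmv_arrows small" "Tgt F = Src G"
  shows "pmv_comp G F \<in> pmv_arrows small"
proof -
  have "rel_comp (rel_of_pmv G) (rel_of_pmv F) \<in> rel_arrows small"
    using assms by (intro rel_comp_in_rel_arrows) (auto simp: pmv_arrows_iff, auto simp: rel_of_pmv_def)
  then show ?thesis
    using assms by (simp add: pmv_arrows_iff[of "pmv_comp G F"] rel_of_pmv_comp) (simp add: pmv_comp_def)
qed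

lemma inj_on_rel_of_pmv: "inj_on rel_of_pmv (pmv_arrows small)"
  by (rule inj_on_inverseI) (rule pmv_of_rel_of_pmv)

section \<open>The isomorphism between the two categories\<close>

lemma rel_of_pmv_Hom:
  "F \<in> Hom (Cat_pmv small) X Y \<Longrightarrow> rel_of_pmv F \<in> Hom (Cat_rel small) X Y"
  by (auto simp: Hom_def Cat_pmv_def Cat_rel_def pmv_arrows_iff) (auto simp: rel_of_pmv_def)

lemma rel_of_pmv_Ident:
  "X \<in> Obj (Cat_pmv small) \<Longrightarrow> rel_of_pmv (Ident (Cat_pmv small) X) = Ident (Cat_rel small) X"
  by (simp add: Cat_pmv_def Cat_rel_def rel_of_pmv_ident)

lemma rel_of_pmv_Comp:
  assumes "composable (Cat_pmv small) G F"
  shows "rel_of_pmv (Comp (Cat_pmv small) G F) = Comp (Cat_rel small) (rel_of_pmv G) (rel_of_pmv F)"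
proof -
  have F: "F \<in> pmv_arrows small" and G: "G \<in> pmv_arrows small" and FG: "Tgt F = Src G"
    using assms by (auto simp: composable_def Cat_pmv_def)
  moreover have "rel_of_pmv F \<in> rel_arrows small" "rel_of_pmv G \<in> rel_arrows small"
    using F G by (auto simp: pmv_arrows_iff)
  moreover have "Tgt (rel_of_pmv F) = Src (rel_of_pmv G)"
    using FG by (simp add: rel_of_pmv_def)
  ultimately show ?thesis
    by (simp add: Cat_pmv_def Cat_rel_def rel_of_pmv_comp)
qed

lemma category_Cat_pmv: "category (Cat_pmv small)"
proof (rule category_reflect[OF category_Cat_rel[of small], where Fo = id and Fa = rel_of_pmv])
  show "Dom (Cat_pmv small) \<in> Arr (Cat_pmv small) \<rightarrow>\<^sub>E Obj (Cat_pmv small)"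
    and "Cod (Cat_pmv small) \<in> Arr (Cat_pmv small) \<rightarrow>\<^sub>E Obj (Cat_pmv small)"
    by (auto simp: Cat_pmv_def pmv_arrows_def)
  show "Ident (Cat_pmv small) \<in> extensional (Obj (Cat_pmv small))"
    and "inj_on rel_of_pmv (Arr (Cat_pmv small))"
    by (simp_all add: Cat_pmv_def inj_on_rel_of_pmv)
next
  fix f g assume "\<not> composable (Cat_pmv small) g f"
  then show "Comp (Cat_pmv small) g f = undefined"
    by (auto simp: Cat_pmv_def composable_def)
next
  fix X assume "X \<in> Obj (Cat_pmv small)"
  then show "Ident (Cat_pmv small) X \<in> Hom (Cat_pmv small) X X"
    using pmv_ident_in_pmv_arrows[of small X] by (simp add: Cat_pmv_def Hom_def) (simp add: pmv_ident_def)
next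
  fix X Y Z f g
  assume "f \<in> Hom (Cat_pmv small) X Y" "g \<in> Hom (Cat_pmv small) Y Z"
  then show "Comp (Cat_pmv small) g f \<in> Hom (Cat_pmv small) X Z"
    using pmv_comp_in_pmv_arrows[of f small g]
    by (auto simp: Cat_pmv_def Hom_def) (auto simp: pmv_comp_def)
next
  fix X Y Z f g
  assume "f \<in> Hom (Cat_pmv small) X Y" "g \<in> Hom (Cat_pmv small) Y Z"
  then show "rel_of_pmv (Comp (Cat_pmv small) g f) =
      Comp (Cat_rel small) (rel_of_pmv g) (rel_of_pmv f)"
    by (intro rel_of_pmv_Comp) (auto simp: composable_def Hom_def)
qed (simp_all add: rel_of_pmv_Hom rel_of_pmv_Ident)

lemma is_functor_rel_of_pmv: "is_functor (Cat_pmv small) (Cat_rel small) id rel_of_pmv"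
  using category_Cat_pmv category_Cat_rel rel_of_pmv_Hom rel_of_pmv_Ident rel_of_pmv_Comp
  by (auto simp: is_functor_def) (simp add: Cat_pmv_def Cat_rel_def)

text \<open>A functor bijective on objects and arrows has a functorial inverse: to identify
  \<open>Ga g\<close> with a candidate arrow of \<open>C\<close>, it suffices that \<open>Fa\<close>
  sends the candidate to \<open>g\<close>. This spares a direct check that taking fibres preserves
  identities and composites.\<close>

lemma is_functor_inverse:
  assumes F: "is_functor C D Fo Fa"
    and Go: "\<And>Y. Y \<in> Obj D \<Longrightarrow> Go Y \<in> Obj C" and Ga: "\<And>g. g \<in> Arr D \<Longrightarrow> Ga g \<in> Arr C"
    and GoFo: "\<And>X. X \<in> Obj C \<Longrightarrow> Go (Fo X) = X" and GaFa: "\<And>f. f \<in> Arr C \<Longrightarrow> Ga (Fa f) = f"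
    and FoGo: "\<And>Y. Y \<in> Obj D \<Longrightarrow> Fo (Go Y) = Y" and FaGa: "\<And>g. g \<in> Arr D \<Longrightarrow> Fa (Ga g) = g"
  shows "is_functor D C Go Ga"
proof -
  interpret C: category C using F by (simp add: is_functor_def)
  interpret D: category D using F by (simp add: is_functor_def)
  have F_Hom: "Fa f \<in> Hom D (Fo (Dom C f)) (Fo (Cod C f))" if "f \<in> Arr C" for f
    proof -
    have "Dom C f \<in> Obj C" "Cod C f \<in> Obj C"
      using C.Dom_closed C.Cod_closed that by auto
    then show ?thesis
      using F that by (simp add: is_functor_def Hom_def)
  qed
  have G_Hom: "Ga g \<in> Hom C (Go X) (Go Y)" if "g \<in> Hom D X Y" for g X Y
  proof -
    have g: "g \<in> Arr D" "Dom D g = X" "Cod D g = Y" using that by (auto simp: Hom_def)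
    have "Dom C (Ga g) \<in> Obj C" "Cod C (Ga g) \<in> Obj C"
      using C.Dom_closed C.Cod_closed Ga[OF g(1)] by auto
    \<comment> \<open>\<open>Fa\<close> returns \<open>Ga g\<close> to \<open>g\<close>, so
      \<open>Fo\<close> maps the endpoints of \<open>Ga g\<close> to those of \<open>g\<close>;
      applying \<open>Go\<close> then recovers the endpoints of \<open>Ga g\<close>.\<close>
    moreover have "Fo (Dom C (Ga g)) = X" "Fo (Cod C (Ga g)) = Y"
      using F_Hom[OF Ga[OF g(1)]] g by (auto simp: Hom_def FaGa)
    ultimately show ?thesis
      using GoFo Ga[OF g(1)] by (auto simp: Hom_def)
  qed
  have "Ga (Ident D Y) = Ident C (Go Y)" if Y: "Y \<in> Obj D" for Y
  proof -
    have "Ident C (Go Y) \<in> Arr C" using C.Ident_Hom[OF Go[OF Y]] by (simp add: Hom_def)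
    moreover have "Fa (Ident C (Go Y)) = Ident D Y"
      using F Go[OF Y] by (simp add: is_functor_def FoGo[OF Y])
    ultimately show ?thesis using GaFa by metis
  qed
  moreover have "Ga (Comp D g f) = Comp C (Ga g) (Ga f)" if "composable D g f" for g f
  proof -
    have f: "f \<in> Hom D (Dom D f) (Cod D f)" and g: "g \<in> Hom D (Cod D f) (Cod D g)"
      using that by (auto simp: composable_def Hom_def)
    have "composable C (Ga g) (Ga f)"
      using G_Hom[OF f] G_Hom[OF g] by (auto simp: composable_def Hom_def)
    then have "Fa (Comp C (Ga g) (Ga f)) = Comp D g f"
      using F f g by (simp add: is_functor_def FaGa Hom_def)
    moreover have "Comp C (Ga g) (Ga f) \<in> Arr C"
      using C.Comp_Hom[OF G_Hom[OF f] G_Hom[OF g]] by (simp add: Hom_def)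
    ultimately show ?thesis using GaFa by metis
  qed
  ultimately show ?thesis
    using Go G_Hom C.category_axioms D.category_axioms by (simp add: is_functor_def)
qed

theorem theorem1p3:
  fixes small :: "'u set \<Rightarrow> bool"
  shows "category (Cat_pmv small) \<and> category (Cat_rel small) \<and>
    isomorphic_categories (Cat_pmv small) (Cat_rel small)"
proof -
  have inv: "\<forall>F \<in> Arr (Cat_pmv small). pmv_of_rel (rel_of_pmv F) = F"
    "\<forall>R \<in> Arr (Cat_rel small). rel_of_pmv (pmv_of_rel R) = R"
    by (simp_all add: Cat_pmv_def Cat_rel_def pmv_of_rel_of_pmv rel_of_pmv_of_rel)
  have "is_functor (Cat_rel small) (Cat_pmv small) id pmv_of_rel"
    by (rule is_functor_inverse[OF is_functor_rel_of_pmv])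
      (use inv in \<open>auto simp: Cat_pmv_def Cat_rel_def pmv_of_rel_in_pmv_arrows\<close>)
  then have "isomorphic_categories (Cat_pmv small) (Cat_rel small)"
    unfolding isomorphic_categories_def using is_functor_rel_of_pmv[of small] inv
    by (intro exI[of _ id] exI[of _ rel_of_pmv] exI[of _ pmv_of_rel]) simp
  then show ?thesis
    using category_Cat_pmv category_Cat_rel by blast
qed

end
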